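(* Let $t_*>0$ and $(a_0,a_1)\in\mathbb R^2$ satisfy $\frac{a_0}{t_*}>a_1$. Then there exists $N\in\mathbb N$ such that for any $n\ge N$ there exist some $\delta_n>0$ and some sequence $\{r_{i,n}\}_{i=1}^n\subset\mathbb R$ such that the locally constant potential $$\phi(x)=r_{x_0,n}\qquad\text{for } x=\cdots x_{-1}x_0x_1\cdots$$ on the full shift space $\Lambda_n^{\mathbb Z}$ satisfies $$P(t\phi)=a_0+a_1(t-t_* )+O\big((t-t_* )^2\big)$$ on $[t_*-\delta_n,t_*+\delta_n]$.
   Context: $\Lambda_n=\{1,2,\dots,n\}$, and $\sigma$ is the shift on $\Lambda_n^{\mathbb Z}$. The pressure of a continuous potential is $P(\phi)=\lim_{m\to\infty}\frac1m\log\sum_{\sigma^m(x)=x}e^{\sum_{i=0}^{m-1}\phi(\sigma^ix)}$, equivalently $\sup\{h(\mu)+\int\phi\,d\mu:\mu\ \sigma\text{-invariant probability}\}$. *)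

theory Defs
  imports Complex_Main "HOL-Library.FuncSet"
begin

text \<open>Points are bi-infinite sequences over the alphabet \<open>{1..n}\<close>; since \<open>n\<close> varies, the
  space is a set of functions rather than a type.\<close>

definition full_shift :: "nat \<Rightarrow> (int \<Rightarrow> nat) set" where
  "full_shift n = UNIV \<rightarrow> {1..n}"

definition shift :: "(int \<Rightarrow> nat) \<Rightarrow> int \<Rightarrow> nat" where
  "shift x = (\<lambda>i. x (i + 1))"

definition periodic_points :: "nat \<Rightarrow> nat \<Rightarrow> (int \<Rightarrow> nat) set" where
  "periodic_points n m = {x \<in> full_shift n. (shift ^^ m) x = x}"

text \<open>For \<open>m \<ge> 1\<close> the set \<open>periodic_points n m\<close> has \<open>n ^ m\<close> elements, so the inner sum is a
  genuine finite sum. The term \<open>m = 0\<close> has no meaning and does not affect the limit.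
  A potential is a function on all integer-indexed sequences of naturals, but only its values
  on \<open>full_shift n\<close> are used.\<close>

definition pressure :: "nat \<Rightarrow> ((int \<Rightarrow> nat) \<Rightarrow> real) \<Rightarrow> real" where
  "pressure n \<phi> =
     lim (\<lambda>m. 1 / real m * ln (\<Sum>x\<in>periodic_points n m. exp (\<Sum>i<m. \<phi> ((shift ^^ i) x))))"

end

theory Submission
  imports Defs "HOL-Real_Asymp.Real_Asymp"
begin

text \<open>
  For a potential that depends on one coordinate the orbit sums over points of period \<open>m\<close>
  factorise, so \<open>P(t\<phi>)\<close> equals the free energy \<open>F(t) = ln (\<Sum>j=1..n. exp (t * r j))\<close>. It
  remains to choose the \<open>r j\<close> with \<open>F(t0) = a0\<close> and \<open>F'(t0) = a1\<close>; the quadratic error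
  bound is then Taylor's theorem.

  Adding a constant \<open>v\<close> to all \<open>r j\<close> adds \<open>t * v\<close> to \<open>F(t)\<close>, so it adjusts \<open>F(t0)\<close> while
  leaving \<open>F(t0) - t0 * F'(t0)\<close> unchanged. This last quantity is the entropy of the Bernoulli
  measure with weights proportional to \<open>exp (t0 * r j)\<close>, and it has to take the value
  \<open>h = a0 - t0 * a1\<close>, which is positive by hypothesis. It suffices to give one symbol the
  value \<open>v + s\<close> and the other \<open>n - 1\<close> symbols the value \<open>v\<close>. The Bernoulli entropy is
  \<open>ln n\<close> for \<open>s = 0\<close>, where the measure is uniform, and tends to \<open>0\<close> as \<open>s\<close> grows,
  where the measure concentrates on one symbol. By the intermediate value theorem it takes
  the value \<open>h\<close> as soon as \<open>ln n > h\<close>, which determines \<open>N\<close>.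
\<close>

section \<open>Pressure of a one-coordinate potential\<close>

lemma shift_funpow: "(shift ^^ m) x = (\<lambda>k. x (k + int m))"
  by (induction m) (auto simp: shift_def algebra_simps)

text \<open>The induction proves \<open>x (k + q * m) = x k\<close> over all integers \<open>q\<close>, which division with
  remainder turns into reduction of the index.\<close>

lemma periodic_mod:
  fixes x :: "int \<Rightarrow> 'a"
  assumes per: "\<And>k. x (k + p) = x k"
  shows "x (k mod p) = x k"
proof -
  have "x (j + q * p) = x j" for j q
  proof (induction q rule: int_induct[of _ 0])
    case base
    show ?case by simp
  next
    case (step1 q)
    then show ?case using per[of "j + q * p"] by (simp add: algebra_simps)
  next
    case (step2 q)
    then show ?case using per[of "j + (q - 1) * p"] by (simp add: algebra_simps)
  qed
  from this[of "k mod p" "k div p"] show ?thesis by simp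
qed

text \<open>A point of period \<open>m\<close> is the same thing as a word of length \<open>m\<close>, and the sum over all
  words of a product of letter weights is the \<open>m\<close>-th power of the total weight.\<close>

lemma sum_periodic_points_prod:
  fixes w :: "nat \<Rightarrow> 'a::comm_semiring_1"
  assumes "m > 0"
  shows "(\<Sum>x\<in>periodic_points n m. \<Prod>i<m. w (x (int i))) = (\<Sum>j=1..n. w j) ^ m"
proof -
  have "(\<Sum>x\<in>periodic_points n m. \<Prod>i<m. w (x (int i)))
      = (\<Sum>f\<in>PiE {..<m} (\<lambda>_. {1..n}). \<Prod>i<m. w (f i))"
  proof (rule sum.reindex_bij_witness[where
        i = "\<lambda>f k. f (nat (k mod int m))" and j = "\<lambda>x. restrict (\<lambda>i. x (int i)) {..<m}"])
    fix x assume x: "x \<in> periodic_points n m"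
    then have "(shift ^^ m) x = x" by (simp add: periodic_points_def)
    then have per: "x (k + int m) = x k" for k
      unfolding shift_funpow by (rule fun_cong)
    have lt: "nat (k mod int m) < m" for k
      using \<open>m > 0\<close> by (simp add: nat_less_iff)
    show "(\<lambda>k. restrict (\<lambda>i. x (int i)) {..<m} (nat (k mod int m))) = x"
      using lt \<open>m > 0\<close> by (simp add: periodic_mod[of x "int m", OF per])
    show "restrict (\<lambda>i. x (int i)) {..<m} \<in> PiE {..<m} (\<lambda>_. {1..n})"
      using x by (auto simp: periodic_points_def full_shift_def Pi_iff)
    show "(\<Prod>i<m. w (restrict (\<lambda>i. x (int i)) {..<m} i)) = (\<Prod>i<m. w (x (int i)))"
      by simp
  next
    fix f assume f: "f \<in> PiE {..<m} (\<lambda>_. {1..n})"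
    show "restrict (\<lambda>i. f (nat (int i mod int m))) {..<m} = f"
    proof
      fix i show "restrict (\<lambda>i. f (nat (int i mod int m))) {..<m} i = f i"
        using PiE_arb[OF f, of i] by (cases "i < m") auto
    qed
    have "f (nat (k mod int m)) \<in> {1..n}" for k
      using f \<open>m > 0\<close> by (intro PiE_mem[OF f]) (simp add: nat_less_iff)
    then show "(\<lambda>k. f (nat (k mod int m))) \<in> periodic_points n m"
      unfolding periodic_points_def full_shift_def shift_funpow by simp
  qed
  also have "\<dots> = (\<Prod>i<m. \<Sum>j=1..n. w j)"
    by (rule prod_sum_PiE[symmetric]) auto
  finally show ?thesis by simp
qed

lemma pressure_coordinate:
  fixes g :: "nat \<Rightarrow> real"
  assumes "n > 0"
  shows "pressure n (\<lambda>x. g (x 0)) = ln (\<Sum>j=1..n. exp (g j))"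
proof -
  let ?Z = "\<Sum>j=1..n. exp (g j)"
  have pos: "?Z > 0" using assms by (intro sum_pos) auto
  have "1 / real m * ln (\<Sum>x\<in>periodic_points n m. exp (\<Sum>i<m. g ((shift ^^ i) x 0))) = ln ?Z"
    if "m > 0" for m
    using that pos sum_periodic_points_prod[OF that, of "\<lambda>j. exp (g j)" n]
    by (simp add: shift_funpow exp_sum ln_realpow)
  then show ?thesis
    unfolding pressure_def
    by (intro limI tendsto_eventually eventually_mono[OF eventually_gt_at_top[of 0]])
qed

section \<open>Prescribing value and slope\<close>

text \<open>For integral \<open>k\<close> the left-hand side is the entropy of a probability vector with one weight
  proportional to \<open>exp y\<close> and \<open>k\<close> weights proportional to \<open>1\<close>. It equals \<open>ln (1 + k)\<close> at
  \<open>y = 0\<close> and tends to \<open>0\<close> as \<open>y\<close> tends to infinity, so the intermediate value theorem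
  applies.\<close>

lemma bernoulli_entropy_attains:
  fixes k h :: real
  assumes "k > 0" "0 < h" "h < ln (1 + k)"
  obtains y where "ln (exp y + k) - y * exp y / (exp y + k) = h"
proof -
  define G where "G y = ln (exp y + k) - y * exp y / (exp y + k)" for y
  have ne: "exp y + k > 0" for y using assms(1) by (simp add: add_pos_pos)
  have "(G \<longlongrightarrow> 0) at_top"
    unfolding G_def using assms(1) by real_asymp
  then have "eventually (\<lambda>y. G y < h \<and> y \<ge> 0) at_top"
    using assms(2) by (intro eventually_conj order_tendstoD(2) eventually_ge_at_top)
  then obtain b where b: "G b < h" "b \<ge> 0"
    by (auto simp: eventually_at_top_linorder)
  have "continuous_on {0..b} G"
    unfolding G_def using ne by (intro continuous_intros) (auto simp: less_imp_neq[symmetric])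
  then obtain y where "G y = h"
    using IVT2'[of G b h 0] b assms(3) by (auto simp: G_def)
  then show thesis using that by (auto simp: G_def)
qed

text \<open>The second derivative of the two-value free energy is \<open>s\<^sup>2 * p * (1 - p)\<close> with
  \<open>p = exp (t * s) / (exp (t * s) + k)\<close>, the variance of a variable with two values at distance
  \<open>s\<close>. It is bounded by \<open>s\<^sup>2\<close> on the whole line, so the estimate is valid for all \<open>t\<close>.\<close>

lemma free_energy_taylor:
  fixes k s t c :: real
  assumes "k > 0"
  shows "\<bar>ln (exp (t * s) + k) - (ln (exp (c * s) + k)
            + s * exp (c * s) / (exp (c * s) + k) * (t - c))\<bar> \<le> s\<^sup>2 * (t - c)\<^sup>2"
proof (cases "t = c")
  case False
  define f f1 f2 where "f t = ln (exp (t * s) + k)"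
    and "f1 t = s * exp (t * s) / (exp (t * s) + k)"
    and "f2 t = s\<^sup>2 * (exp (t * s) * k / (exp (t * s) + k)\<^sup>2)" for t
  have pos: "exp z + k > 0" for z using assms by (simp add: add_pos_pos)
  note nz = pos[THEN less_imp_neq, symmetric]
  have d1: "(f has_real_derivative f1 x) (at x)" for x
    unfolding f_def f1_def using pos by (auto intro!: derivative_eq_intros)
  have d2: "(f1 has_real_derivative f2 x) (at x)" for x
    unfolding f1_def f2_def using nz[of "x * s"]
    by (auto intro!: derivative_eq_intros simp: divide_simps power2_eq_square)
       (simp add: algebra_simps)
  have bound: "\<bar>f2 x\<bar> \<le> s\<^sup>2" for x
  proof -
    have "0 \<le> exp (x * s) * k / (exp (x * s) + k)\<^sup>2" using assms by simp
    moreover have "exp (x * s) * k \<le> (exp (x * s) + k)\<^sup>2"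
      using assms by (simp add: power2_sum)
    then have "exp (x * s) * k / (exp (x * s) + k)\<^sup>2 \<le> 1"
      using nz[of "x * s"] by (simp add: divide_le_eq_1)
    ultimately have "0 \<le> f2 x" "f2 x \<le> s\<^sup>2"
      unfolding f2_def by (intro mult_nonneg_nonneg mult_left_le; simp)+
    then show ?thesis by simp
  qed
  define D where "D m = (if m = 0 then f else if m = 1 then f1 else f2)" for m :: nat
  have DD: "\<forall>m x. m < 2 \<and> min t c \<le> x \<and> x \<le> max t c \<longrightarrow> DERIV (D m) x :> D (Suc m) x"
  proof (intro allI impI)
    fix m :: nat and x assume "m < 2 \<and> min t c \<le> x \<and> x \<le> max t c"
    then have "m = 0 \<or> m = 1" by auto
    then show "DERIV (D m) x :> D (Suc m) x"
      using d1[of x] d2[of x] by (auto simp: D_def)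
  qed
  obtain \<xi> where "f t = (\<Sum>m<2. D m c / fact m * (t - c) ^ m) + D 2 \<xi> / fact 2 * (t - c) ^ 2"
    using Taylor[OF _ _ DD, of f c t] False by (auto simp: D_def)
  then have "f t - (f c + f1 c * (t - c)) = f2 \<xi> / 2 * (t - c)\<^sup>2"
    by (simp add: D_def numeral_2_eq_2)
  moreover have "\<bar>f2 \<xi> / 2 * (t - c)\<^sup>2\<bar> \<le> s\<^sup>2 * (t - c)\<^sup>2"
    unfolding abs_mult using bound[of \<xi>] by (intro mult_mono) auto
  ultimately have "\<bar>f t - (f c + f1 c * (t - c))\<bar> \<le> s\<^sup>2 * (t - c)\<^sup>2" by (simp only:)
  then show ?thesis unfolding f_def f1_def .
qed simp

theorem corollary5p7:
  fixes t0 a0 a1 :: real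
  assumes "t0 > 0" and "a0 / t0 > a1"
  shows "\<exists>N::nat. \<forall>n\<ge>N. \<exists>\<delta>>0. \<exists>r :: nat \<Rightarrow> real.
           \<exists>C. \<forall>t\<in>{t0 - \<delta>..t0 + \<delta>}.
             \<bar>pressure n (\<lambda>x. t * r (x 0)) - (a0 + a1 * (t - t0))\<bar> \<le> C * (t - t0)\<^sup>2"
proof -
  define h where "h = a0 - t0 * a1"
  have h: "h > 0" using assms by (simp add: h_def field_simps)
  obtain N :: nat where N: "exp h < real N" using reals_Archimedean2 by blast
  show ?thesis
  proof (intro exI[of _ N] allI impI)
    fix n assume "n \<ge> N"
    define k where "k = real (n - 1)"
    have en: "exp h < real n" using N \<open>n \<ge> N\<close> by linarith
    have n1: "real n > 1" using en h one_less_exp_iff[of h] by linarith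
    have k: "k > 0" "1 + k = real n" using n1 by (auto simp: k_def of_nat_diff)
    have "h < ln (1 + k)" using en n1 k ln_less_cancel_iff[of "exp h" "real n"] by simp
    then obtain y where y: "ln (exp y + k) - y * exp y / (exp y + k) = h"
      using bernoulli_entropy_attains k(1) h by blast
    define s v where "s = y / t0" and "v = (a0 - ln (exp y + k)) / t0"
    define r where "r j = (if j = 1 then v + s else v)" for j :: nat
    have ts: "t0 * s = y" using assms(1) by (simp add: s_def)
    \<comment> \<open>The choice of \<open>v\<close> fixes the value; the slope then follows from the entropy.\<close>
    have val: "t0 * v + ln (exp (t0 * s) + k) = a0"
      using assms(1) by (simp add: v_def ts)
    have "t0 * (v + s * exp (t0 * s) / (exp (t0 * s) + k)) = t0 * v + y * exp y / (exp y + k)"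
      by (simp add: algebra_simps flip: ts)
    also have "\<dots> = t0 * a1" using val y by (simp add: ts h_def)
    finally have slope: "v + s * exp (t0 * s) / (exp (t0 * s) + k) = a1"
      using assms(1) by simp
    have P: "pressure n (\<lambda>x. t * r (x 0)) = t * v + ln (exp (t * s) + k)" for t
    proof -
      have "(\<Sum>j=1..n. exp (t * r j)) = exp (t * r 1) + (\<Sum>j=2..n. exp (t * r j))"
        using n1 by (subst sum.atLeast_Suc_atMost) (auto simp: numeral_2_eq_2)
      also have "(\<Sum>j=2..n. exp (t * r j)) = (\<Sum>j=2..n. exp (t * v))"
        by (rule sum.cong) (auto simp: r_def)
      also have "exp (t * r 1) + \<dots> = exp (t * v) * (exp (t * s) + k)"
        using n1 by (simp add: r_def k_def algebra_simps exp_add of_nat_diff)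
      finally have "pressure n (\<lambda>x. t * r (x 0)) = ln (exp (t * v) * (exp (t * s) + k))"
        using n1 by (subst pressure_coordinate) auto
      also have "\<dots> = t * v + ln (exp (t * s) + k)"
        using add_pos_pos[OF exp_gt_zero[of "t * s"] k(1)] by (simp add: ln_mult)
      finally show ?thesis .
    qed
    have "\<bar>pressure n (\<lambda>x. t * r (x 0)) - (a0 + a1 * (t - t0))\<bar> \<le> s\<^sup>2 * (t - t0)\<^sup>2" for t
    proof -
      have "pressure n (\<lambda>x. t * r (x 0)) - (a0 + a1 * (t - t0))
          = ln (exp (t * s) + k) - (ln (exp (t0 * s) + k)
              + s * exp (t0 * s) / (exp (t0 * s) + k) * (t - t0))"
        unfolding P val[symmetric] slope[symmetric] by (simp add: algebra_simps)
      then show ?thesis using free_energy_taylor[OF k(1), of t s t0] by simp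
    qed
    then show "\<exists>\<delta>>0. \<exists>r :: nat \<Rightarrow> real. \<exists>C. \<forall>t\<in>{t0 - \<delta>..t0 + \<delta>}.
             \<bar>pressure n (\<lambda>x. t * r (x 0)) - (a0 + a1 * (t - t0))\<bar> \<le> C * (t - t0)\<^sup>2"
      using zero_less_one by blast
  qed
qed

end
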